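(* For every $n\in\mathbb{N}$, $$\sum_{k=0}^{2n}(-1)^kW_{-k}\star G_{2n-k}=(-1)^n[2]_q^{2n}x(yyxx)^n=\sum_{k=0}^{2n}(-1)^kG_{2n-k}\star W_{-k},$$ $$q\sum_{k=0}^{2n+1}(-1)^kW_{-k}\star G_{2n+1-k}=(-1)^n[2]_q^{2n+1}yxx(yyxx)^n=q^{-1}\sum_{k=0}^{2n+1}(-1)^kG_{2n+1-k}\star W_{-k}.$$
   Context: Let $\mathbb{F}$ be a field of characteristic zero and let $q\in\mathbb{F}$ be nonzero and not a root of unity; $\mathbb{N}=\{0,1,2,\ldots\}$; $[2]_q=q+q^{-1}$. Let $\mathbb{V}$ be the free associative unital $\mathbb{F}$-algebra on two noncommuting generators (letters) $x,y$; the words in $x,y$ (including the trivial word $\mathbf{1}$) form a basis of $\mathbb{V}$. Words such as $(xxyy)^nx$ are written with respect to the free (concatenation) product. The $q$-shuffle product $\star$ on the vector space $\mathbb{V}$ is the bilinear associative product with unit $\mathbf{1}$ determined as follows. Put $\langle x,x\rangle=\langle y,y\rangle=2$ and $\langle x,y\rangle=\langle y,x\rangle=-2$. For nontrivial words $u=u_1\cdots u_r$ and $v=v_1\cdots v_s$, $$u\star v=u_1\big((u_2\cdots u_r)\star v\big)+v_1\big(u\star(v_2\cdots v_s)\big)q^{\langle v_1,u_1\rangle+\cdots+\langle v_1,u_r\rangle}.$$ The alternating words are, for $n\in\mathbb{N}$ (powers in the free product): $\tilde{G}_{n+1}=(xy)^{n+1}$, $G_{n+1}=(yx)^{n+1}$,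 $W_{-n}=(xy)^nx$, $W_{n+1}=(yx)^ny$; also $G_0=\tilde{G}_0=\mathbf{1}$. *)

theory Defs
  imports Complex_Main "HOL-Library.Poly_Mapping"
begin

datatype letter = LX | LY

text \<open>
  Words are lists of letters.  With concatenation as the (additively written) monoid operation,
  the convolution product of \<^theory>\<open>HOL-Library.Poly_Mapping\<close> makes \<open>letter list \<Rightarrow>\<^sub>0 'f\<close> the monoid
  algebra of the free monoid, that is, the free associative unital algebra \<open>V\<close> on two letters:
  \<open>*\<close>, \<open>^\<close> and \<open>1\<close> are the free product, its powers and the trivial word, and the words
  \<open>Poly_Mapping.single w 1\<close> form a basis.
\<close>

instantiation list :: (type) monoid_add
begin

definition zero_list :: "'a list" where
  "zero_list = []"

definition plus_list :: "'a list \<Rightarrow> 'a list \<Rightarrow> 'a list" where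
  "plus_list = append"

instance
  by standard (simp_all add: zero_list_def plus_list_def)

end

type_synonym 'f freealg = "letter list \<Rightarrow>\<^sub>0 'f"

definition word :: "letter list \<Rightarrow> 'f::field freealg" where
  "word w = Poly_Mapping.single w 1"

definition genX :: "'f::field freealg" where
  "genX = word [LX]"

definition genY :: "'f::field freealg" where
  "genY = word [LY]"

definition scaleV :: "'f::field \<Rightarrow> 'f freealg \<Rightarrow> 'f freealg"  (infixr \<open>*\<^sub>V\<close> 75) where
  "c *\<^sub>V f = Poly_Mapping.map ((*) c) f"

definition letter_form :: "letter \<Rightarrow> letter \<Rightarrow> int" where
  "letter_form a b = (if a = b then 2 else -2)"

fun word_shuffle :: "'f::field \<Rightarrow> letter list \<Rightarrow> letter list \<Rightarrow> 'f freealg" where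
  "word_shuffle q [] v = word v"
| "word_shuffle q (a # u) [] = word (a # u)"
| "word_shuffle q (a # u) (b # v) =
     word [a] * word_shuffle q u (b # v)
     + (q powi (\<Sum>c\<leftarrow>a # u. letter_form b c)) *\<^sub>V (word [b] * word_shuffle q (a # u) v)"

text \<open>The \<open>q\<close>-shuffle product is the bilinear extension of its values on words.\<close>

definition qshuffle :: "'f::field \<Rightarrow> 'f freealg \<Rightarrow> 'f freealg \<Rightarrow> 'f freealg" where
  "qshuffle q f g =
     (\<Sum>u\<in>Poly_Mapping.keys f. \<Sum>v\<in>Poly_Mapping.keys g.
        (Poly_Mapping.lookup f u * Poly_Mapping.lookup g v) *\<^sub>V word_shuffle q u v)"

abbreviation qshuffle_syntax ::
    "'f::field freealg \<Rightarrow> 'f \<Rightarrow> 'f freealg \<Rightarrow> 'f freealg"  (\<open>_ \<star>\<^bsub>_\<^esub> _\<close> [71, 0, 70] 70) where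
  "f \<star>\<^bsub>q\<^esub> g \<equiv> qshuffle q f g"

definition qtwo :: "'f::field \<Rightarrow> 'f" where
  "qtwo q = q + inverse q"

text \<open>
  The alternating words \<open>W\<close> are indexed by all integers:
  \<open>W\<^bsub>-n\<^esub> = (xy)\<^sup>nx\<close> and \<open>W\<^bsub>n+1\<^esub> = (yx)\<^sup>ny\<close> for natural \<open>n\<close>.
\<close>

definition altW :: "int \<Rightarrow> 'f::field freealg" where
  "altW k = (if k \<le> 0 then (genX * genY) ^ nat (- k) * genX
             else (genY * genX) ^ nat (k - 1) * genY)"

definition altG :: "nat \<Rightarrow> 'f::field freealg" where
  "altG n = (genY * genX) ^ n"

lemma lookup_scaleV [simp]:
  "Poly_Mapping.lookup (c *\<^sub>V f) w = c * Poly_Mapping.lookup f w"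
  by (simp add: scaleV_def Poly_Mapping.map.rep_eq when_def)

lemma scaleV_zero [simp]: "0 *\<^sub>V f = 0" "c *\<^sub>V 0 = 0"
  by (simp_all add: poly_mapping_eq_iff fun_eq_iff)

lemma scaleV_one [simp]: "1 *\<^sub>V f = f"
  by (simp add: poly_mapping_eq_iff fun_eq_iff)

lemma scaleV_scaleV: "c *\<^sub>V d *\<^sub>V f = (c * d) *\<^sub>V f"
  by (simp add: poly_mapping_eq_iff fun_eq_iff mult.assoc)

lemma scaleV_add_left: "(c + d) *\<^sub>V f = c *\<^sub>V f + d *\<^sub>V f"
  by (simp add: poly_mapping_eq_iff fun_eq_iff lookup_add algebra_simps)

lemma scaleV_add_right: "c *\<^sub>V (f + g) = c *\<^sub>V f + c *\<^sub>V g"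
  by (simp add: poly_mapping_eq_iff fun_eq_iff lookup_add algebra_simps)

lemma scaleV_sum: "c *\<^sub>V (\<Sum>i\<in>A. f i) = (\<Sum>i\<in>A. c *\<^sub>V f i)"
  by (induction A rule: infinite_finite_induct) (simp_all add: scaleV_add_right)

lemma word_mult: "word u * word v = word (u @ v)"
  by (simp add: word_def mult_single plus_list_def)

lemma word_Nil: "word [] = 1"
  by (simp add: word_def flip: zero_list_def)

lemma qshuffle_word: "word u \<star>\<^bsub>q\<^esub> word v = word_shuffle q u v"
  by (simp add: qshuffle_def word_def)

lemma qshuffle_superset:
  assumes "finite A" "finite B" "Poly_Mapping.keys f \<subseteq> A" "Poly_Mapping.keys g \<subseteq> B"
  shows "f \<star>\<^bsub>q\<^esub> g = (\<Sum>u\<in>A. \<Sum>v\<in>B.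
           (Poly_Mapping.lookup f u * Poly_Mapping.lookup g v) *\<^sub>V word_shuffle q u v)"
proof -
  have "(\<Sum>u\<in>Poly_Mapping.keys f. \<Sum>v\<in>Poly_Mapping.keys g.
          (Poly_Mapping.lookup f u * Poly_Mapping.lookup g v) *\<^sub>V word_shuffle q u v)
      = (\<Sum>u\<in>Poly_Mapping.keys f. \<Sum>v\<in>B.
          (Poly_Mapping.lookup f u * Poly_Mapping.lookup g v) *\<^sub>V word_shuffle q u v)"
    using assms by (intro sum.cong refl sum.mono_neutral_left) (auto simp: in_keys_iff)
  also have "\<dots> = (\<Sum>u\<in>A. \<Sum>v\<in>B.
          (Poly_Mapping.lookup f u * Poly_Mapping.lookup g v) *\<^sub>V word_shuffle q u v)"
    using assms by (intro sum.mono_neutral_left) (auto simp: in_keys_iff)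
  finally show ?thesis
    by (simp add: qshuffle_def)
qed

lemma qshuffle_add_left: "(f + f') \<star>\<^bsub>q\<^esub> g = f \<star>\<^bsub>q\<^esub> g + f' \<star>\<^bsub>q\<^esub> g"
proof -
  let ?A = "Poly_Mapping.keys f \<union> Poly_Mapping.keys f'" and ?B = "Poly_Mapping.keys g"
  have "Poly_Mapping.keys (f + f') \<subseteq> ?A"
    by (rule Poly_Mapping.keys_add)
  then show ?thesis
    by (simp add: qshuffle_superset[of ?A ?B] lookup_add algebra_simps scaleV_add_left sum.distrib)
qed

lemma qshuffle_add_right: "f \<star>\<^bsub>q\<^esub> (g + g') = f \<star>\<^bsub>q\<^esub> g + f \<star>\<^bsub>q\<^esub> g'"
proof -
  let ?A = "Poly_Mapping.keys f" and ?B = "Poly_Mapping.keys g \<union> Poly_Mapping.keys g'"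
  have "Poly_Mapping.keys (g + g') \<subseteq> ?B"
    by (rule Poly_Mapping.keys_add)
  then show ?thesis
    by (simp add: qshuffle_superset[of ?A ?B] lookup_add algebra_simps scaleV_add_left sum.distrib)
qed

lemma keys_scaleV: "Poly_Mapping.keys (c *\<^sub>V f) \<subseteq> Poly_Mapping.keys f"
  by (auto simp: in_keys_iff)

lemma qshuffle_scaleV_left: "(c *\<^sub>V f) \<star>\<^bsub>q\<^esub> g = c *\<^sub>V (f \<star>\<^bsub>q\<^esub> g)"
  by (simp add: qshuffle_superset[of "Poly_Mapping.keys f" "Poly_Mapping.keys g"]
      keys_scaleV scaleV_sum scaleV_scaleV mult.assoc)

lemma qshuffle_scaleV_right: "f \<star>\<^bsub>q\<^esub> (c *\<^sub>V g) = c *\<^sub>V (f \<star>\<^bsub>q\<^esub> g)"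
  by (simp add: qshuffle_superset[of "Poly_Mapping.keys f" "Poly_Mapping.keys g"]
      keys_scaleV scaleV_sum scaleV_scaleV algebra_simps)

lemma word_shuffle_Nil_right: "word_shuffle q u [] = word u"
  by (cases u) simp_all

lemma qshuffle_word_Cons:
  "word (a # u) \<star>\<^bsub>q\<^esub> word (b # v) =
     word [a] * (word u \<star>\<^bsub>q\<^esub> word (b # v))
     + (q powi (\<Sum>c\<leftarrow>a # u. letter_form b c)) *\<^sub>V (word [b] * (word (a # u) \<star>\<^bsub>q\<^esub> word v))"
  by (simp add: qshuffle_word)

end

theory Submission
  imports Defs
begin

text \<open>
  The words \<open>W\<^bsub>-k\<^esub> = x G\<^sub>k\<close> and \<open>G\<^bsub>k+1\<^esub> = y W\<^bsub>-k\<^esub>\<close> are obtained from each other by adding a first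
  letter.  Splitting off the first letter in each product therefore expresses the four alternating
  convolutions of \<open>W\<close> and \<open>G\<close> with each other through convolutions of smaller total length.  Since
  \<open>W\<^bsub>-k\<^esub>\<close> has the weight of \<open>x\<close> and \<open>G\<^sub>k\<close> has weight \<open>0\<close>, the powers of \<open>q\<close> that occur depend only
  on the kind of convolution, and the recursion, which has period two, is solved at once:
  the convolution of \<open>W\<close> with \<open>W\<close> vanishes in odd degree, and so does that of \<open>G\<close> with \<open>G\<close>.
\<close>

text \<open>Scaling by \<open>c\<close> is multiplication by \<open>Poly_Mapping.single 0 c\<close>,
  a multiple of the trivial word, and this commutes with every word.\<close>

lemma word_mult_scaleV: "word w * (c *\<^sub>V f) = c *\<^sub>V (word w * f)"
proof -
  have "word w * Poly_Mapping.single 0 c = Poly_Mapping.single 0 c * word w"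
    by (simp add: word_def mult_single)
  then show ?thesis
    by (simp add: scaleV_def mult_map_scale_conv_mult flip: mult.assoc)
qed

lemma scaleV_uminus_left: "(- c) *\<^sub>V f = - (c *\<^sub>V f)"
  by (simp add: poly_mapping_eq_iff fun_eq_iff)

lemma scaleV_uminus_right: "c *\<^sub>V (- f) = - (c *\<^sub>V f)"
  by (simp add: poly_mapping_eq_iff fun_eq_iff)

text \<open>Explicit lists expose the first letters, on which the recursion of
  \<open>word_shuffle\<close> acts.\<close>

primrec yx_list :: "nat \<Rightarrow> letter list" where
  "yx_list 0 = []"
| "yx_list (Suc k) = LY # LX # yx_list k"

text \<open>Each block \<open>yx\<close> contributes 2 - 2 for either letter \<open>a\<close>, so
  only a leading \<open>x\<close> of the left factor can affect the exponent of
  \<open>q\<close>.\<close>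

lemma sum_letter_form_yx_list: "(\<Sum>c\<leftarrow>yx_list k. letter_form a c) = 0"
  by (induction k; cases a) (simp_all add: letter_form_def)

lemma altG_eq_word: "altG k = word (yx_list k)"
  unfolding altG_def
  by (induction k) (simp_all add: word_Nil genX_def genY_def word_mult)

lemma power_mult_shift: "(a * b) ^ k * a = a * (b * a) ^ k" for a :: "'a::monoid_mult"
  by (induction k) (simp_all add: mult.assoc)

definition W :: "nat \<Rightarrow> 'f::field freealg" where
  "W k = altW (- int k)"

lemma W_eq_word: "W k = word (LX # yx_list k)"
proof -
  have "W k = genX * (altG k :: 'a::field freealg)"
    by (simp add: W_def altW_def altG_def power_mult_shift)
  then show ?thesis
    by (simp add: altG_eq_word genX_def word_mult)
qed

context
  fixes q :: "'f::field"
begin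

lemma W_shuffle_G_0: "W k \<star>\<^bsub>q\<^esub> altG 0 = genX * (altG k \<star>\<^bsub>q\<^esub> altG 0)"
  by (simp add: altG_eq_word W_eq_word qshuffle_word word_shuffle_Nil_right genX_def word_mult)

text \<open>The letter \<open>y\<close> moves past \<open>x\<close> followed by a word of weight 0,
  which costs \<open>q\<close> to the power -2. In \<open>W_shuffle_W\<close> the moving letter is
  \<open>x\<close>, hence \<open>q ^ 2\<close>; a left factor \<open>altG (Suc k)\<close> has weight
  0 and produces no power of \<open>q\<close>.\<close>

lemma W_shuffle_G_Suc:
  "W k \<star>\<^bsub>q\<^esub> altG (Suc m) =
     genX * (altG k \<star>\<^bsub>q\<^esub> altG (Suc m)) + inverse (q ^ 2) *\<^sub>V (genY * (W k \<star>\<^bsub>q\<^esub> W m))"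
  by (simp add: altG_eq_word W_eq_word qshuffle_word sum_letter_form_yx_list letter_form_def
      genX_def genY_def power_int_minus)

lemma G_0_shuffle_W: "altG 0 \<star>\<^bsub>q\<^esub> W m = genX * (altG 0 \<star>\<^bsub>q\<^esub> altG m)"
  by (simp add: altG_eq_word W_eq_word qshuffle_word genX_def word_mult)

lemma G_Suc_shuffle_W:
  "altG (Suc k) \<star>\<^bsub>q\<^esub> W m =
     genY * (W k \<star>\<^bsub>q\<^esub> W m) + genX * (altG (Suc k) \<star>\<^bsub>q\<^esub> altG m)"
  by (simp add: altG_eq_word W_eq_word qshuffle_word sum_letter_form_yx_list letter_form_def
      genX_def genY_def)

lemma G_0_shuffle_G_Suc: "altG 0 \<star>\<^bsub>q\<^esub> altG (Suc m) = genY * (altG 0 \<star>\<^bsub>q\<^esub> W m)"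
  by (simp add: altG_eq_word W_eq_word qshuffle_word genY_def word_mult)

lemma G_Suc_shuffle_G_0: "altG (Suc k) \<star>\<^bsub>q\<^esub> altG 0 = genY * (W k \<star>\<^bsub>q\<^esub> altG 0)"
  by (simp add: altG_eq_word W_eq_word qshuffle_word word_shuffle_Nil_right genY_def word_mult)

lemma G_Suc_shuffle_G_Suc:
  "altG (Suc k) \<star>\<^bsub>q\<^esub> altG (Suc m) =
     genY * (W k \<star>\<^bsub>q\<^esub> altG (Suc m)) + genY * (altG (Suc k) \<star>\<^bsub>q\<^esub> W m)"
  by (simp add: altG_eq_word W_eq_word qshuffle_word sum_letter_form_yx_list letter_form_def
      genY_def)

lemma W_shuffle_W:
  "W k \<star>\<^bsub>q\<^esub> W m = genX * (altG k \<star>\<^bsub>q\<^esub> W m) + q ^ 2 *\<^sub>V (genX * (W k \<star>\<^bsub>q\<^esub> altG m))"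
  by (simp add: altG_eq_word W_eq_word qshuffle_word sum_letter_form_yx_list letter_form_def
      genX_def)

text \<open>This is the coefficient of t^n in F(-t) \<star> H(t), where F and H are the generating
  functions of \<open>f\<close> and \<open>g\<close>.\<close>

definition alt_conv :: "(nat \<Rightarrow> 'f freealg) \<Rightarrow> (nat \<Rightarrow> 'f freealg) \<Rightarrow> nat \<Rightarrow> 'f freealg" where
  "alt_conv f g n = (\<Sum>k\<le>n. (-1) ^ k *\<^sub>V (f k \<star>\<^bsub>q\<^esub> g (n - k)))"

lemma gen_mult_scaleV: "genX * (c *\<^sub>V f) = c *\<^sub>V (genX * f)" "genY * (c *\<^sub>V f) = c *\<^sub>V (genY * f)"
  by (simp_all add: genX_def genY_def word_mult_scaleV)

lemma gen_mult_alt_conv: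
  "genX * alt_conv f g n = (\<Sum>k\<le>n. (-1) ^ k *\<^sub>V (genX * (f k \<star>\<^bsub>q\<^esub> g (n - k))))"
  "genY * alt_conv f g n = (\<Sum>k\<le>n. (-1) ^ k *\<^sub>V (genY * (f k \<star>\<^bsub>q\<^esub> g (n - k))))"
  by (simp_all add: alt_conv_def sum_distrib_left gen_mult_scaleV)

text \<open>Isolates the summand with right index 0, where the right factor may be the trivial word
  and has no first letter to split off.\<close>

lemma alt_conv_Suc:
  "alt_conv f g (Suc n) =
     (\<Sum>k\<le>n. (-1) ^ k *\<^sub>V (f k \<star>\<^bsub>q\<^esub> g (Suc (n - k)))) + (-1) ^ Suc n *\<^sub>V (f (Suc n) \<star>\<^bsub>q\<^esub> g 0)"
  by (simp add: alt_conv_def Suc_diff_le)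

text \<open>Isolates the summand with left index 0 instead; shifting the remaining left indices by
  one reverses their sign.\<close>

lemma alt_conv_Suc':
  "alt_conv f g (Suc n) =
     f 0 \<star>\<^bsub>q\<^esub> g (Suc n) - (\<Sum>k\<le>n. (-1) ^ k *\<^sub>V (f (Suc k) \<star>\<^bsub>q\<^esub> g (n - k)))"
  by (simp add: alt_conv_def sum.atMost_Suc_shift scaleV_uminus_left sum_negf del: sum.atMost_Suc)

lemma scaleV_commute: "c *\<^sub>V d *\<^sub>V f = d *\<^sub>V c *\<^sub>V f" for c d :: 'f
  by (simp add: scaleV_scaleV mult.commute)

text \<open>The leading \<open>y\<close> comes from the right factor, so \<open>k\<close> and its
  sign are unchanged. In \<open>conv_GW_Suc\<close> it comes from the left factor, which lowers
  \<open>k\<close> by one and gives the minus sign.\<close>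

lemma conv_WG_Suc:
  "alt_conv W altG (Suc n) =
     genX * alt_conv altG altG (Suc n) + inverse (q ^ 2) *\<^sub>V (genY * alt_conv W W n)"
  unfolding gen_mult_alt_conv(2) distrib_left alt_conv_Suc
  by (simp add: W_shuffle_G_0 W_shuffle_G_Suc scaleV_add_right sum.distrib scaleV_sum
      sum_distrib_left gen_mult_scaleV distrib_left scaleV_commute)

lemma conv_GW_Suc:
  "alt_conv altG W (Suc n) = genX * alt_conv altG altG (Suc n) - genY * alt_conv W W n"
  unfolding gen_mult_alt_conv(2) right_diff_distrib alt_conv_Suc'
  by (simp add: G_0_shuffle_W G_Suc_shuffle_W scaleV_add_right sum.distrib
      sum_distrib_left gen_mult_scaleV)

lemma conv_WW: "alt_conv W W n = genX * (alt_conv altG W n + q ^ 2 *\<^sub>V alt_conv W altG n)"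
  unfolding distrib_left gen_mult_scaleV gen_mult_alt_conv unfolding alt_conv_def
  by (simp add: W_shuffle_W scaleV_add_right sum.distrib scaleV_sum scaleV_commute)

lemma conv_GG_Suc:
  "alt_conv altG altG (Suc n) = genY * (alt_conv altG W n - alt_conv W altG n)"
proof -
  \<comment> \<open>\<open>P\<close> and \<open>Q\<close> collect the parts whose leading
    \<open>y\<close> comes from the left and the right factor; the value 0 covers a trivial factor.
    Both factors cannot be trivial, since the indices add up to \<open>Suc n\<close>.\<close>
  define P where "P k m = (case k of 0 \<Rightarrow> 0 | Suc k' \<Rightarrow> genY * (W k' \<star>\<^bsub>q\<^esub> altG m))" for k m
  define Q where "Q k m = (case m of 0 \<Rightarrow> 0 | Suc m' \<Rightarrow> genY * (altG k \<star>\<^bsub>q\<^esub> W m'))" for k m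
  have split: "altG k \<star>\<^bsub>q\<^esub> altG (Suc n - k) = P k (Suc n - k) + Q k (Suc n - k)" if "k \<le> Suc n" for k
    using that by (cases k; cases "Suc n - k")
      (auto simp: P_def Q_def G_0_shuffle_G_Suc G_Suc_shuffle_G_0 G_Suc_shuffle_G_Suc)
  have "alt_conv altG altG (Suc n) =
      (\<Sum>k\<le>Suc n. (-1) ^ k *\<^sub>V P k (Suc n - k)) + (\<Sum>k\<le>Suc n. (-1) ^ k *\<^sub>V Q k (Suc n - k))"
    unfolding alt_conv_def sum.distrib[symmetric]
    by (intro sum.cong refl) (simp add: split scaleV_add_right)
  also have "(\<Sum>k\<le>Suc n. (-1) ^ k *\<^sub>V P k (Suc n - k)) = - (genY * alt_conv W altG n)"
    unfolding gen_mult_alt_conv sum.atMost_Suc_shift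
    by (simp add: P_def scaleV_uminus_left sum_negf)
  also have "(\<Sum>k\<le>Suc n. (-1) ^ k *\<^sub>V Q k (Suc n - k)) = genY * alt_conv altG W n"
    unfolding gen_mult_alt_conv by (simp add: Q_def Suc_diff_le)
  finally show ?thesis
    by (simp add: right_diff_distrib)
qed

text \<open>Reversing the summation moves the sign from the index of \<open>W\<close> to that of
  \<open>altG\<close>, at the cost of a global sign.\<close>

lemma conv_GW_rev:
  "(\<Sum>k=0..n. (-1) ^ k *\<^sub>V (altG (n - k) \<star>\<^bsub>q\<^esub> W k)) = (-1) ^ n *\<^sub>V alt_conv altG W n"
proof -
  have "(\<Sum>k=0..n. (-1) ^ k *\<^sub>V (altG (n - k) \<star>\<^bsub>q\<^esub> W k)) =
      (\<Sum>k=0..n. (-1) ^ (n - k) *\<^sub>V (altG k \<star>\<^bsub>q\<^esub> W (n - k)))"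
    by (subst sum.atLeastAtMost_rev) (simp add: atLeast0AtMost)
  also have "\<dots> = (\<Sum>k=0..n. (-1) ^ n *\<^sub>V (-1) ^ k *\<^sub>V (altG k \<star>\<^bsub>q\<^esub> W (n - k)))"
    by (intro sum.cong refl) (simp add: scaleV_scaleV minus_one_power_iff)
  finally show ?thesis
    by (simp add: alt_conv_def scaleV_sum atLeast0AtMost)
qed

text \<open>Equal values in an even degree kill the G-G convolution one degree later; the resulting
  odd values kill the W-W convolution, which makes the values in the next even degree equal
  again.\<close>

lemma conv_even_odd:
  assumes "q \<noteq> 0"
  defines "E \<equiv> \<lambda>n. ((-1) ^ n * qtwo q ^ (2 * n)) *\<^sub>V (genX * (genY * genY * genX * genX) ^ n)"
  shows "alt_conv W altG (2 * n) = E n" and "alt_conv altG W (2 * n) = E n"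
    and "alt_conv W altG (2 * n + 1) = (inverse q * qtwo q) *\<^sub>V (genY * genX * E n)"
    and "alt_conv altG W (2 * n + 1) = - ((q * qtwo q) *\<^sub>V (genY * genX * E n))"
proof -
  \<comment> \<open>If both convolutions equal \<open>f\<close> in degree \<open>m\<close>, only the
    W-W term survives in the next degree, and it carries the factor
    \<open>1 + q ^ 2\<close>.\<close>
  have odd: "alt_conv W altG (Suc m) = (inverse q * qtwo q) *\<^sub>V (genY * genX * f)"
      "alt_conv altG W (Suc m) = - ((q * qtwo q) *\<^sub>V (genY * genX * f))"
    if "alt_conv W altG m = f" "alt_conv altG W m = f" for m f
  proof -
    have WW: "alt_conv W W m = (1 + q ^ 2) *\<^sub>V (genX * f)"
      unfolding conv_WW that by (simp add: distrib_left scaleV_add_left gen_mult_scaleV)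
    have q2: "1 + q ^ 2 = q * qtwo q"
      using assms(1) by (simp add: qtwo_def field_simps power2_eq_square)
    have GG: "alt_conv altG altG (Suc m) = 0"
      unfolding conv_GG_Suc that by simp
    show "alt_conv altG W (Suc m) = - ((q * qtwo q) *\<^sub>V (genY * genX * f))"
      unfolding conv_GW_Suc GG WW by (simp add: gen_mult_scaleV mult.assoc q2)
    have "inverse (q ^ 2) * (1 + q ^ 2) = inverse q * qtwo q"
      using assms(1) by (simp add: qtwo_def field_simps power2_eq_square)
    then show "alt_conv W altG (Suc m) = (inverse q * qtwo q) *\<^sub>V (genY * genX * f)"
      unfolding conv_WG_Suc GG WW
      by (simp add: gen_mult_scaleV scaleV_scaleV mult.assoc)
  qed
  \<comment> \<open>The prefix \<open>xyyx\<close> is absorbed because \<open>xyyx\<close> followed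
    by \<open>x(yyxx)^n\<close> is \<open>x(yyxx)^(n+1)\<close>.\<close>
  have E_Suc: "E (Suc n) = - ((qtwo q ^ 2) *\<^sub>V (genX * (genY * (genY * (genX * E n)))))" for n
  proof -
    have "genX * (genY * (genY * (genX * (genX * (genY * genY * genX * genX) ^ n)))) =
        genX * (genY * genY * genX * genX) ^ Suc n"
      by (simp add: mult.assoc)
    then show ?thesis
      by (simp add: E_def gen_mult_scaleV scaleV_scaleV scaleV_uminus_left power2_eq_square mult_ac
          del: power_Suc) (simp add: scaleV_uminus_left mult_ac)
  qed
  have even: "alt_conv W altG (2 * n) = E n \<and> alt_conv altG W (2 * n) = E n"
  proof (induction n)
    case 0
    show ?case
      by (simp add: alt_conv_def E_def altG_eq_word W_eq_word qshuffle_word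
          genX_def)
  next
    case (Suc n)
    define f where "f = E n"
    have IH: "alt_conv W altG (2 * n) = f" "alt_conv altG W (2 * n) = f"
      using Suc by (simp_all add: f_def)
    have "alt_conv altG W (Suc (2 * n)) - alt_conv W altG (Suc (2 * n)) =
        - ((q * qtwo q + inverse q * qtwo q) *\<^sub>V (genY * genX * f))"
      unfolding odd[OF IH] by (simp add: scaleV_add_left)
    also have "q * qtwo q + inverse q * qtwo q = qtwo q ^ 2"
      by (simp add: qtwo_def power2_eq_square algebra_simps)
    finally have GG: "alt_conv altG altG (Suc (Suc (2 * n))) =
        - (qtwo q ^ 2 *\<^sub>V (genY * (genY * (genX * f))))"
      unfolding conv_GG_Suc by (simp add: gen_mult_scaleV mult.assoc)
    \<comment> \<open>The weight \<open>q ^ 2\<close> in \<open>conv_WW\<close> makes the two odd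
      values cancel, leaving only the G-G term in degree \<open>2 * n + 2\<close>.\<close>
    have coeff: "q ^ 2 * (inverse q * qtwo q) = q * qtwo q"
      using assms(1) by (simp add: power2_eq_square)
    have WW: "alt_conv W W (Suc (2 * n)) = 0"
      unfolding conv_WW odd[OF IH] scaleV_scaleV coeff by simp
    show ?case
      unfolding mult_Suc_right add_2_eq_Suc conv_WG_Suc conv_GW_Suc GG WW E_Suc
      by (simp add: gen_mult_scaleV f_def)
  qed
  show "alt_conv W altG (2 * n) = E n" "alt_conv altG W (2 * n) = E n"
    using even by simp_all
  then show "alt_conv W altG (2 * n + 1) = (inverse q * qtwo q) *\<^sub>V (genY * genX * E n)"
    "alt_conv altG W (2 * n + 1) = - ((q * qtwo q) *\<^sub>V (genY * genX * E n))"
    using odd[of "2 * n" "E n"] by simp_all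
qed

end

theorem proposition5p6:
  fixes q :: "'f::field_char_0" and n :: nat
  assumes "q \<noteq> 0"
    and "\<And>m::nat. m > 0 \<Longrightarrow> q ^ m \<noteq> 1"
  shows
    "(\<Sum>k=0..2*n. (-1) ^ k *\<^sub>V (altW (- int k) \<star>\<^bsub>q\<^esub> altG (2*n - k)))
       = ((-1) ^ n * qtwo q ^ (2*n)) *\<^sub>V (genX * (genY * genY * genX * genX) ^ n)
     \<and> ((-1) ^ n * qtwo q ^ (2*n)) *\<^sub>V (genX * (genY * genY * genX * genX) ^ n)
       = (\<Sum>k=0..2*n. (-1) ^ k *\<^sub>V (altG (2*n - k) \<star>\<^bsub>q\<^esub> altW (- int k)))
     \<and> q *\<^sub>V (\<Sum>k=0..2*n+1. (-1) ^ k *\<^sub>V (altW (- int k) \<star>\<^bsub>q\<^esub> altG (2*n+1 - k)))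
       = ((-1) ^ n * qtwo q ^ (2*n+1))
           *\<^sub>V (genY * genX * genX * (genY * genY * genX * genX) ^ n)
     \<and> ((-1) ^ n * qtwo q ^ (2*n+1))
           *\<^sub>V (genY * genX * genX * (genY * genY * genX * genX) ^ n)
       = inverse q *\<^sub>V
           (\<Sum>k=0..2*n+1. (-1) ^ k *\<^sub>V (altG (2*n+1 - k) \<star>\<^bsub>q\<^esub> altW (- int k)))"
proof -
  let ?f = "genX * (genY * genY * genX * genX) ^ n :: 'f freealg"
  have conv: "(\<Sum>k=0..m. (-1) ^ k *\<^sub>V (W k \<star>\<^bsub>q\<^esub> altG (m - k))) =
      alt_conv q W altG m" for m
    by (simp add: alt_conv_def atLeast0AtMost)
  have yx: "genY * genX * (c *\<^sub>V ?f) = c *\<^sub>V (genY * genX * genX * (genY * genY * genX * genX) ^ n)"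
    for c :: 'f
    by (simp add: gen_mult_scaleV mult.assoc)
  have cancel: "q * (a * (inverse q * b)) = a * b" for a b
    using assms(1) by simp
  show ?thesis
    \<comment> \<open>In odd degree the sign from \<open>conv_GW_rev\<close> cancels the minus sign
      of the G-W value, and the outer factors \<open>q\<close> and \<open>inverse q\<close> leave a
      single further \<open>qtwo q\<close> on each side.\<close>
    unfolding W_def[symmetric] unfolding conv conv_GW_rev conv_even_odd[OF assms(1)] yx
    by (simp add: scaleV_scaleV scaleV_uminus_left scaleV_uminus_right mult_ac cancel)
qed

end
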